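(* There exist a minimal subshift $X \subseteq \{0,1\}^{\mathbb{Z}}$ and points $x_z \in X$, indexed by $z \in \{0,1\}^{\mathbb{N}}$, such that for all $z \neq z'$ in $\{0,1\}^{\mathbb{N}}$: the Turing degrees $\deg_T x_z$ and $\deg_T x_{z'}$ are incomparable, and there is no point $y \in X$ with both $\deg_T y \leq_T \deg_T x_z$ and $\deg_T y \leq_T \deg_T x_{z'}$.
   Context: A subshift of $\{0,1\}^{\mathbb{Z}}$ is a nonempty-or-empty closed (in the product topology) subset invariant under the shift $\sigma(c)_n = c_{n+1}$ and its inverse; its elements are called points. A subshift $X$ is minimal if it is nonempty and contains no nonempty subshift $Y \subsetneq X$ (equivalently, all points of $X$ contain the same finite patterns). The Turing degree of a point of $\{0,1\}^{\mathbb{Z}}$ is the Turing degree of the sequence obtained by listing its values along a fixed computable bijection $\mathbb{N} \to \mathbb{Z}$. *)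

theory Defs
  imports "HOL-Analysis.Analysis"
begin

type_synonym point = "int \<Rightarrow> bool"

definition shift :: "point \<Rightarrow> point" where
  "shift c = (\<lambda>n. c (n + 1))"

definition shift_inv :: "point \<Rightarrow> point" where
  "shift_inv c = (\<lambda>n. c (n - 1))"

definition cantor_top :: "point topology" where
  "cantor_top = product_topology (\<lambda>_. discrete_topology UNIV) UNIV"

definition subshift :: "point set \<Rightarrow> bool" where
  "subshift X \<longleftrightarrow> closedin cantor_top X \<and>
     (\<forall>c\<in>X. shift c \<in> X \<and> shift_inv c \<in> X)"

definition minimal_subshift :: "point set \<Rightarrow> bool" where
  "minimal_subshift X \<longleftrightarrow> subshift X \<and> X \<noteq> {} \<and>
     \<not> (\<exists>Y. subshift Y \<and> Y \<noteq> {} \<and> Y \<subset> X)"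

text \<open>rec_in f k g: g is a total k-ary function (arguments as a list of length k)
  that is mu-recursive relative to the oracle f.\<close>
inductive rec_in :: "(nat \<Rightarrow> nat) \<Rightarrow> nat \<Rightarrow> (nat list \<Rightarrow> nat) \<Rightarrow> bool"
  for f :: "nat \<Rightarrow> nat" where
  r_zero: "rec_in f k (\<lambda>xs. 0)"
| r_succ: "rec_in f 1 (\<lambda>xs. Suc (hd xs))"
| r_proj: "i < k \<Longrightarrow> rec_in f k (\<lambda>xs. xs ! i)"
| r_oracle: "rec_in f 1 (\<lambda>xs. f (hd xs))"
| r_comp: "rec_in f m h \<Longrightarrow> length gs = m \<Longrightarrow> (\<forall>g\<in>set gs. rec_in f k g) \<Longrightarrow>
           rec_in f k (\<lambda>xs. h (map (\<lambda>g. g xs) gs))"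
| r_primrec: "rec_in f k g \<Longrightarrow> rec_in f (Suc (Suc k)) h \<Longrightarrow>
           rec_in f (Suc k)
             (\<lambda>xs. rec_nat (g (tl xs)) (\<lambda>n r. h (r # n # tl xs)) (hd xs))"
| r_mu: "rec_in f (Suc k) g \<Longrightarrow> (\<forall>xs. length xs = k \<longrightarrow> (\<exists>y. g (y # xs) = 0)) \<Longrightarrow>
           rec_in f k (\<lambda>xs. LEAST y. g (y # xs) = 0)"

definition turing_le :: "(nat \<Rightarrow> nat) \<Rightarrow> (nat \<Rightarrow> nat) \<Rightarrow> bool" where
  "turing_le g f \<longleftrightarrow> (\<exists>p. rec_in f 1 p \<and> (\<forall>n. p [n] = g n))"

definition nat_to_int :: "nat \<Rightarrow> int" where
  "nat_to_int n = (if even n then int (n div 2) else - int (n div 2) - 1)"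

definition point_seq :: "point \<Rightarrow> nat \<Rightarrow> nat" where
  "point_seq c n = (if c (nat_to_int n) then 1 else 0)"

definition point_turing_le :: "point \<Rightarrow> point \<Rightarrow> bool" where
  "point_turing_le x y \<longleftrightarrow> turing_le (point_seq x) (point_seq y)"

end

theory Submission
  imports Defs
begin

text \<open>
  Oracle computations form a countable family of partial functionals, each value of which depends
  on a finite window of the oracle. The subshift is built generically: stage \<open>n\<close> fixes finitely many
  blocks of a common length, the points of the subshift are to be translates of concatenations of
  these blocks, and every new block contains all pairs of old ones, which makes the limit minimal.
  A tree of windows around the origin, indexed by binary words, grows along and defines the
  points \<open>x z\<close>.

  Given two functionals and two incomparable nodes of the tree, either the windows can be extended
  so that the two outputs differ somewhere, or all common outputs of the functionals above these
  nodes coincide. In the latter case it suffices to omit a single point from the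
  subshift. An incomparability requirement needs no separate treatment: if \<open>x z\<close> were computable
  from \<open>x z'\<close>, it would itself be a point of the subshift below both.
\<close>

section \<open>Oracle programs as continuous partial functionals\<close>

text \<open>Syntax for the rules of \<open>rec_in\<close>. Being a countable datatype, it lets the
  pairs of programs be listed as requirements. Arities are left out; argument lists of the wrong
  length merely produce arbitrary values.\<close>

datatype code =
    Zero | Succ | Proj nat | Oracle | Comp code "code list" | Prec code code | Mu code

instance code :: countable
  by countable_datatype

fun sequence_opts :: "'a option list \<Rightarrow> 'a list option" where
  "sequence_opts [] = Some []"
| "sequence_opts (None # os) = None"
| "sequence_opts (Some x # os) = map_option (Cons x) (sequence_opts os)"

text \<open>An earlier undefined value blocks the search. If it were skipped, a change of the oracle
  arbitrarily far out could turn it into zero and alter the result, contrary to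
  \<open>run_use\<close>.\<close>

definition mu_halts :: "(nat \<Rightarrow> nat option) \<Rightarrow> nat \<Rightarrow> bool" where
  "mu_halts h y \<longleftrightarrow> h y = Some 0 \<and> (\<forall>y'<y. \<exists>v. h y' = Some (Suc v))"

primrec run :: "code \<Rightarrow> (nat \<Rightarrow> nat) \<Rightarrow> nat list \<Rightarrow> nat option" where
  "run Zero = (\<lambda>f xs. Some 0)"
| "run Succ = (\<lambda>f xs. Some (Suc (hd xs)))"
| "run (Proj i) = (\<lambda>f xs. Some (xs ! i))"
| "run Oracle = (\<lambda>f xs. Some (f (hd xs)))"
| "run (Comp h gs) = (\<lambda>f xs. Option.bind (sequence_opts (map (\<lambda>r. r f xs) (map run gs))) (run h f))"
| "run (Prec g h) = (\<lambda>f xs. rec_nat (run g f (tl xs))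
     (\<lambda>n r. Option.bind r (\<lambda>r. run h f (r # n # tl xs))) (hd xs))"
| "run (Mu g) = (\<lambda>f xs. if \<exists>y. mu_halts (\<lambda>y. run g f (y # xs)) y
     then Some (LEAST y. run g f (y # xs) = Some 0) else None)"

lemma mu_halts_Least: "mu_halts h y \<Longrightarrow> (LEAST y. h y = Some 0) = y"
  unfolding mu_halts_def
  by (rule Least_equality) (auto, metis Zero_not_Suc not_le option.inject)

lemma run_Mu_eq_Some: "run (Mu g) f xs = Some y \<longleftrightarrow> mu_halts (\<lambda>y. run g f (y # xs)) y"
  by (auto dest: mu_halts_Least)

lemma sequence_opts_eq_Some: "sequence_opts os = Some vs \<longleftrightarrow> os = map Some vs"
proof (induction os arbitrary: vs rule: sequence_opts.induct)
  case (3 x os)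
  then show ?case by (cases vs) auto
qed auto

text \<open>Induction on the derivation, each rule giving the matching constructor. The totality
  premise of \<open>r_mu\<close> makes the search halt with defined values all along.\<close>

lemma rec_in_imp_run:
  assumes "rec_in f k p"
  shows "\<exists>c. \<forall>xs. length xs = k \<longrightarrow> run c f xs = Some (p xs)"
  using assms
proof induction
  case (r_zero k)
  show ?case by (rule exI[of _ Zero]) simp
next
  case r_succ
  show ?case by (rule exI[of _ Succ]) simp
next
  case (r_proj i k)
  show ?case by (rule exI[of _ "Proj i"]) simp
next
  case r_oracle
  show ?case by (rule exI[of _ Oracle]) simp
next
  case (r_comp m h gs k)
  from r_comp.IH obtain d where d: "\<And>xs. length xs = m \<Longrightarrow> run d f xs = Some (h xs)" by blast
  from r_comp.IH obtain e where
    e: "\<And>g xs. g \<in> set gs \<Longrightarrow> length xs = k \<Longrightarrow> run (e g) f xs = Some (g xs)" by metis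
  have "run (Comp d (map e gs)) f xs = Some (h (map (\<lambda>g. g xs) gs))" if "length xs = k" for xs
  proof -
    have "sequence_opts (map (\<lambda>r. r f xs) (map run (map e gs))) = Some (map (\<lambda>g. g xs) gs)"
      unfolding sequence_opts_eq_Some using e that by simp
    then show ?thesis using d r_comp.hyps by simp
  qed
  then show ?case by blast
next
  case (r_primrec k g h)
  from r_primrec.IH obtain d e where
    d: "\<And>xs. length xs = k \<Longrightarrow> run d f xs = Some (g xs)" and
    e: "\<And>xs. length xs = Suc (Suc k) \<Longrightarrow> run e f xs = Some (h xs)" by blast
  have "run (Prec d e) f xs = Some (rec_nat (g (tl xs)) (\<lambda>n r. h (r # n # tl xs)) (hd xs))"
    if "length xs = Suc k" for xs
  proof -
    have "rec_nat (run d f (tl xs)) (\<lambda>n r. Option.bind r (\<lambda>r. run e f (r # n # tl xs))) m =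
        Some (rec_nat (g (tl xs)) (\<lambda>n r. h (r # n # tl xs)) m)" for m
      by (induction m) (use that d e in auto)
    then show ?thesis by simp
  qed
  then show ?case by blast
next
  case (r_mu k g)
  from r_mu.IH obtain d where d: "\<And>xs. length xs = Suc k \<Longrightarrow> run d f xs = Some (g xs)" by blast
  have "run (Mu d) f xs = Some (LEAST y. g (y # xs) = 0)" if "length xs = k" for xs
  proof -
    have "\<exists>y. g (y # xs) = 0" using r_mu.hyps that by blast
    then have "g ((LEAST y. g (y # xs) = 0) # xs) = 0" by (rule LeastI_ex)
    moreover have "\<exists>v. g (y # xs) = Suc v" if "y < (LEAST y. g (y # xs) = 0)" for y
      using not_less_Least[OF that] not0_implies_Suc by blast
    ultimately show ?thesis
      unfolding run_Mu_eq_Some mu_halts_def using d that by simp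
  qed
  then show ?case by blast
qed

text \<open>The use principle: a halting computation rests on finitely many halting subcomputations,
  and a bound beyond all their uses works. Sums serve as common bounds because each summand is at
  most the sum.\<close>

lemma run_use:
  assumes "run c f xs = Some v"
  shows "\<exists>N. \<forall>f'. (\<forall>i<N. f' i = f i) \<longrightarrow> run c f' xs = Some v"
  using assms
proof (induction c arbitrary: xs v)
  case Oracle
  then show ?case by (intro exI[of _ "Suc (hd xs)"]) simp
next
  case (Comp h gs)
  then obtain vs where vs: "sequence_opts (map (\<lambda>r. r f xs) (map run gs)) = Some vs"
    and h: "run h f vs = Some v"
    by (auto simp: bind_eq_Some_conv)
  from vs have len: "length vs = length gs"
    by (metis sequence_opts_eq_Some length_map)
  have "run (gs ! i) f xs = Some (vs ! i)" if "i < length gs" for i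
    using vs that len unfolding sequence_opts_eq_Some by (metis length_map nth_map)
  then have "\<forall>i<length gs. \<exists>N. \<forall>f'. (\<forall>j<N. f' j = f j) \<longrightarrow> run (gs ! i) f' xs = Some (vs ! i)"
    using Comp.IH(2) nth_mem by blast
  then obtain N where N: "\<And>i f'. i < length gs \<Longrightarrow> \<forall>j<N i. f' j = f j \<Longrightarrow>
      run (gs ! i) f' xs = Some (vs ! i)" by metis
  obtain N' where N': "\<And>f'. \<forall>j<N'. f' j = f j \<Longrightarrow> run h f' vs = Some v"
    using Comp.IH(1)[OF h] by blast
  show ?case
  proof (intro exI allI impI)
    fix f' assume f': "\<forall>j<N' + (\<Sum>i<length gs. N i). f' j = f j"
    have "run (gs ! i) f' xs = Some (vs ! i)" if "i < length gs" for i
    proof -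
      have "N i \<le> (\<Sum>i<length gs. N i)" using that by (intro member_le_sum) auto
      then show ?thesis using N[OF that] f' by simp
    qed
    then have "map (\<lambda>r. r f' xs) (map run gs) = map Some vs"
      using len by (intro nth_equalityI) auto
    then have "sequence_opts (map (\<lambda>r. r f' xs) (map run gs)) = Some vs"
      by (simp only: sequence_opts_eq_Some)
    then show "run (Comp h gs) f' xs = Some v" using N' f' by simp
  qed
next
  case (Prec g h)
  have "\<exists>N. \<forall>f'. (\<forall>i<N. f' i = f i) \<longrightarrow>
      rec_nat (run g f' (tl xs)) (\<lambda>n r. Option.bind r (\<lambda>r. run h f' (r # n # tl xs))) m = Some v"
    if "rec_nat (run g f (tl xs)) (\<lambda>n r. Option.bind r (\<lambda>r. run h f (r # n # tl xs))) m = Some v"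
    for m v
    using that
  proof (induction m arbitrary: v)
    case 0
    then show ?case using Prec.IH(1) by simp
  next
    case (Suc m)
    then obtain r where
      r: "rec_nat (run g f (tl xs)) (\<lambda>n r. Option.bind r (\<lambda>r. run h f (r # n # tl xs))) m = Some r"
      and h: "run h f (r # m # tl xs) = Some v"
      by (auto simp: bind_eq_Some_conv)
    obtain N where N: "\<And>f'. \<forall>i<N. f' i = f i \<Longrightarrow>
      rec_nat (run g f' (tl xs)) (\<lambda>n r. Option.bind r (\<lambda>r. run h f' (r # n # tl xs))) m = Some r"
      using Suc.IH[OF r] by blast
    obtain N' where N': "\<And>f'. \<forall>i<N'. f' i = f i \<Longrightarrow> run h f' (r # m # tl xs) = Some v"
      using Prec.IH(2)[OF h] by blast
    show ?case by (intro exI[of _ "N + N'"]) (use N N' in simp)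
  qed
  then show ?case using Prec.prems by simp
next
  case (Mu g)
  have h: "mu_halts (\<lambda>y. run g f (y # xs)) v" using Mu.prems unfolding run_Mu_eq_Some .
  then have "\<forall>y. \<exists>w. y \<le> v \<longrightarrow> run g f (y # xs) = Some w \<and> (w = 0 \<longleftrightarrow> y = v)"
    unfolding mu_halts_def by (metis le_neq_implies_less less_irrefl nat.distinct(1))
  then obtain w where
    w: "\<And>y. y \<le> v \<Longrightarrow> run g f (y # xs) = Some (w y)" "\<And>y. y \<le> v \<Longrightarrow> w y = 0 \<longleftrightarrow> y = v"
    by metis
  have "\<forall>y. \<exists>N. y \<le> v \<longrightarrow> (\<forall>f'. (\<forall>i<N. f' i = f i) \<longrightarrow> run g f' (y # xs) = Some (w y))"
    using Mu.IH w(1) by blast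
  then obtain N where N: "\<And>y f'. y \<le> v \<Longrightarrow> \<forall>i<N y. f' i = f i \<Longrightarrow> run g f' (y # xs) = Some (w y)"
    by metis
  show ?case
  proof (intro exI allI impI)
    fix f' assume f': "\<forall>i<(\<Sum>y\<le>v. N y). f' i = f i"
    have "run g f' (y # xs) = Some (w y)" if "y \<le> v" for y
    proof -
      have "N y \<le> (\<Sum>y\<le>v. N y)" using that by (intro member_le_sum) auto
      then show ?thesis using N[OF that] f' by simp
    qed
    then show "run (Mu g) f' xs = Some v"
      unfolding run_Mu_eq_Some mu_halts_def
      using w(2) by (metis less_imp_le less_irrefl not0_implies_Suc order_refl)
  qed
qed auto

section \<open>Windows around the origin and functionals on points\<close>

definition agree :: "int \<Rightarrow> point \<Rightarrow> point \<Rightarrow> bool" where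
  "agree n x y \<longleftrightarrow> (\<forall>m. -n \<le> m \<and> m < n \<longrightarrow> x m = y m)"

lemma agree_refl [simp]: "agree n x x"
  by (simp add: agree_def)

lemma agree_trans: "agree n x y \<Longrightarrow> agree n y z \<Longrightarrow> agree n x z"
  by (simp add: agree_def)

lemma agree_mono: "agree n x y \<Longrightarrow> m \<le> n \<Longrightarrow> agree m x y"
  by (auto simp: agree_def)

definition continuous_functional :: "(point \<Rightarrow> nat \<Rightarrow> nat option) \<Rightarrow> bool" where
  "continuous_functional F \<longleftrightarrow>
     (\<forall>x n v. F x n = Some v \<longrightarrow> (\<exists>N. \<forall>x'. agree N x x' \<longrightarrow> F x' n = Some v))"

definition maps_to :: "(point \<Rightarrow> nat \<Rightarrow> nat option) \<Rightarrow> point \<Rightarrow> point \<Rightarrow> bool" where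
  "maps_to F x y \<longleftrightarrow> (\<forall>n. F x n = Some (point_seq y n))"

definition program :: "code \<Rightarrow> point \<Rightarrow> nat \<Rightarrow> nat option" where
  "program c x n = run c (point_seq x) [n]"

lemma continuous_program: "continuous_functional (program c)"
  unfolding continuous_functional_def program_def
proof (intro allI impI)
  fix x n v assume "run c (point_seq x) [n] = Some v"
  then obtain N where
    N: "\<And>f'. \<forall>i<N. f' i = point_seq x i \<Longrightarrow> run c f' [n] = Some v"
    using run_use by blast
  have "run c (point_seq x') [n] = Some v" if a: "agree (int N) x x'" for x'
  proof (rule N, intro allI impI)
    fix i assume "i < N"
    \<comment> \<open>Even indices list \<open>0, 1, ...\<close> and odd ones
      \<open>-1, -2, ...\<close>, so the first \<open>N\<close> positions stay in the half-open
      window of radius \<open>N\<close>.\<close>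
    then have "- int N \<le> nat_to_int i \<and> nat_to_int i < int N"
      by (auto simp: nat_to_int_def)
    then show "point_seq x' i = point_seq x i"
      using a by (simp add: point_seq_def agree_def)
  qed
  then show "\<exists>N. \<forall>x'. agree N x x' \<longrightarrow> run c (point_seq x') [n] = Some v" by blast
qed

lemma point_turing_le_imp_program:
  assumes "point_turing_le y x"
  shows "\<exists>c. maps_to (program c) x y"
proof -
  obtain p where p: "rec_in (point_seq x) 1 p" "\<forall>n. p [n] = point_seq y n"
    using assms by (auto simp: point_turing_le_def turing_le_def)
  obtain c where "\<forall>xs. length xs = 1 \<longrightarrow> run c (point_seq x) xs = Some (p xs)"
    using rec_in_imp_run[OF p(1)] by blast
  then have "maps_to (program c) x y"
    using p(2) by (simp add: maps_to_def program_def)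
  then show ?thesis ..
qed

lemma point_turing_le_refl: "point_turing_le x x"
  unfolding point_turing_le_def turing_le_def
  using rec_in.r_oracle by fastforce

text \<open>\<open>nat_to_int\<close> is onto, so a point can be recovered from its listing. Hence a
  functional has at most one output point at a given oracle.\<close>

lemma point_seq_inject: "point_seq x = point_seq y \<longleftrightarrow> x = y"
proof
  assume eq: "point_seq x = point_seq y"
  have "\<exists>n. nat_to_int n = m" for m
  proof (cases "m \<ge> 0")
    case True
    then show ?thesis by (intro exI[of _ "2 * nat m"]) (simp add: nat_to_int_def)
  next
    case False
    then show ?thesis by (intro exI[of _ "Suc (2 * nat (- m - 1))"]) (simp add: nat_to_int_def)
  qed
  moreover have "x (nat_to_int n) = y (nat_to_int n)" for n
    using fun_cong[OF eq, of n] by (simp add: point_seq_def split: if_splits)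
  ultimately show "x = y" by (intro ext) metis
qed simp

section \<open>Freely concatenated blocks\<close>

text \<open>\<open>B\<close> is the set of all concatenations, cut at the multiples of
  \<open>L\<close>, of some set of words of length \<open>L\<close>. The words are not stored: they
  are those standing at any block \<open>k'\<close> of any point of \<open>B\<close>.\<close>

definition free_blocks :: "int \<Rightarrow> point set \<Rightarrow> bool" where
  "free_blocks L B \<longleftrightarrow> 0 < L \<and>
     (\<forall>x. (\<forall>k. \<exists>b\<in>B. \<exists>k'. \<forall>j. 0 \<le> j \<and> j < L \<longrightarrow> x (k * L + j) = b (k' * L + j)) \<longrightarrow> x \<in> B)"

lemma free_blocks_pos: "free_blocks L B \<Longrightarrow> 0 < L"
  by (simp add: free_blocks_def)

lemma free_blocks_memI:
  assumes "free_blocks L B"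
    and "\<And>k. \<exists>b\<in>B. \<exists>k'. \<forall>j. 0 \<le> j \<and> j < L \<longrightarrow> x (k * L + j) = b (k' * L + j)"
  shows "x \<in> B"
  using assms unfolding free_blocks_def by blast

lemma free_blocks_shift:
  assumes "free_blocks L B" "x \<in> B"
  shows "(\<lambda>m. x (m + k * L)) \<in> B"
proof (rule free_blocks_memI[OF assms(1)])
  fix i
  show "\<exists>b\<in>B. \<exists>k'. \<forall>j. 0 \<le> j \<and> j < L \<longrightarrow> x (i * L + j + k * L) = b (k' * L + j)"
    by (rule bexI[OF _ assms(2)], rule exI[of _ "i + k"]) (simp add: algebra_simps)
qed

text \<open>Membership is decided block by block, and each single block of \<open>x\<close> lies in
  a window on which \<open>x\<close> agrees with a point of \<open>B\<close>.\<close>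

lemma free_blocks_closed:
  assumes "free_blocks L B" and "\<And>n. \<exists>y\<in>B. agree n y x"
  shows "x \<in> B"
proof (rule free_blocks_memI[OF assms(1)])
  fix k
  obtain y where y: "y \<in> B" "agree (\<bar>k * L\<bar> + L) y x" using assms(2) by blast
  have "x (k * L + j) = y (k * L + j)" if "0 \<le> j \<and> j < L" for j
    using y(2) that abs_ge_self[of "k * L"] abs_ge_minus_self[of "k * L"]
    by (simp add: agree_def)
  with y(1) show "\<exists>b\<in>B. \<exists>k'. \<forall>j. 0 \<le> j \<and> j < L \<longrightarrow> x (k * L + j) = b (k' * L + j)"
    by blast
qed

section \<open>Closedness of the set of translates\<close>

definition translates :: "point set \<Rightarrow> point set" where
  "translates B = {x. \<exists>p. (\<lambda>m. x (m + p)) \<in> B}"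

lemma translates_mono: "A \<subseteq> B \<Longrightarrow> translates A \<subseteq> translates B"
  by (auto simp: translates_def)

lemma subset_translates: "B \<subseteq> translates B"
  by (auto simp: translates_def intro: exI[of _ 0])

lemma translates_shift: "x \<in> translates B \<Longrightarrow> (\<lambda>m. x (m + q)) \<in> translates B"
proof -
  assume "x \<in> translates B"
  then obtain p where "(\<lambda>m. x (m + p)) \<in> B" by (auto simp: translates_def)
  then have "(\<lambda>m. x (m + (p - q) + q)) \<in> B" by simp
  then show ?thesis unfolding translates_def by blast
qed

lemma topspace_cantor [simp]: "topspace cantor_top = UNIV"
  by (simp add: cantor_top_def PiE_UNIV_domain)

lemma openin_cantor_iff:
  "openin cantor_top V \<longleftrightarrow>
     (\<forall>x\<in>V. \<exists>U. finite {i. U i \<noteq> UNIV} \<and> x \<in> Pi UNIV U \<and> Pi UNIV U \<subseteq> V)"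
  by (simp add: cantor_top_def openin_product_topology_alt PiE_UNIV_domain)

text \<open>A basic open set restricts finitely many coordinates, so it contains all points that
  agree with a given member on a large enough window.\<close>

lemma closedin_cantor_iff:
  "closedin cantor_top X \<longleftrightarrow> (\<forall>x. (\<forall>n. \<exists>y\<in>X. agree n y x) \<longrightarrow> x \<in> X)"
proof
  assume c: "closedin cantor_top X"
  show "\<forall>x. (\<forall>n. \<exists>y\<in>X. agree n y x) \<longrightarrow> x \<in> X"
  proof (intro allI impI, rule ccontr)
    fix x assume x: "\<forall>n. \<exists>y\<in>X. agree n y x" and "x \<notin> X"
    have "openin cantor_top (- X)"
      using c by (simp add: closedin_def Compl_eq_Diff_UNIV)
    with \<open>x \<notin> X\<close> obtain U where
      U: "finite {i. U i \<noteq> UNIV}" "x \<in> Pi UNIV U" "Pi UNIV U \<subseteq> - X"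
      unfolding openin_cantor_iff by blast
    \<comment> \<open>The sum dominates the absolute value of every restricted coordinate.\<close>
    define N where "N = 1 + (\<Sum>i | U i \<noteq> UNIV. \<bar>i\<bar>)"
    have N: "\<bar>i\<bar> < N" if "U i \<noteq> UNIV" for i
      using member_le_sum[of i "{i. U i \<noteq> UNIV}" abs] that U(1) by (simp add: N_def)
    obtain y where y: "y \<in> X" "agree N y x" using x by blast
    have "y i \<in> U i" for i
    proof (cases "U i = UNIV")
      case False
      then have "y i = x i" using N[OF False] y(2) by (simp add: agree_def abs_less_iff)
      then show ?thesis using U(2) by (simp add: Pi_iff)
    qed simp
    then have "y \<in> Pi UNIV U" by simp
    with U(3) y(1) show False by blast
  qed
next
  assume X: "\<forall>x. (\<forall>n. \<exists>y\<in>X. agree n y x) \<longrightarrow> x \<in> X"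
  have "openin cantor_top (- X)"
    unfolding openin_cantor_iff
  proof (intro ballI)
    fix x assume "x \<in> - X"
    then obtain n where n: "\<And>y. y \<in> X \<Longrightarrow> \<not> agree n y x" using X by blast
    let ?U = "\<lambda>i. if -n \<le> i \<and> i < n then {x i} else UNIV"
    have "{i. ?U i \<noteq> UNIV} \<subseteq> {-n..<n}" by auto
    then have "finite {i. ?U i \<noteq> UNIV}" by (rule finite_subset) simp
    moreover have "Pi UNIV ?U \<subseteq> - X"
    proof
      fix y assume "y \<in> Pi UNIV ?U"
      then have y: "y i \<in> ?U i" for i by (simp only: Pi_iff UNIV_I simp_thms)
      have "agree n y x" unfolding agree_def
      proof (intro allI impI)
        fix i assume "-n \<le> i \<and> i < n"
        then show "y i = x i" using y[of i] by simp
      qed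
      with n show "y \<in> - X" by blast
    qed
    moreover have "x \<in> Pi UNIV ?U" by simp
    ultimately show "\<exists>U. finite {i. U i \<noteq> UNIV} \<and> x \<in> Pi UNIV U \<and> Pi UNIV U \<subseteq> - X"
      by (intro exI[of _ ?U] conjI)
  qed
  then show "closedin cantor_top X"
    by (simp add: closedin_def Compl_eq_Diff_UNIV)
qed

text \<open>Since \<open>B\<close> is invariant under shifts by \<open>L\<close>, the offsets from
  \<open>0\<close> to \<open>L - 1\<close> suffice. This makes the set of translates a finite union
  of closed sets.\<close>

lemma closedin_translates:
  assumes "free_blocks L B"
  shows "closedin cantor_top (translates B)"
proof -
  note L = free_blocks_pos[OF assms]
  have "translates B = (\<Union>p\<in>{0..<L}. {x. (\<lambda>m. x (m + p)) \<in> B})"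
  proof (intro equalityI subsetI)
    fix x assume "x \<in> translates B"
    then obtain p where p: "(\<lambda>m. x (m + p)) \<in> B" by (auto simp: translates_def)
    have "(\<lambda>m. x (m + (- (p div L)) * L + p)) \<in> B"
      using free_blocks_shift[OF assms p] .
    moreover have "m + (- (p div L)) * L + p = m + p mod L" for m
      by (simp add: minus_div_mult_eq_mod[symmetric])
    ultimately have "(\<lambda>m. x (m + p mod L)) \<in> B" by (simp only:)
    then show "x \<in> (\<Union>p\<in>{0..<L}. {x. (\<lambda>m. x (m + p)) \<in> B})"
      using L by (intro UN_I[of "p mod L"]) simp_all
  next
    fix x assume "x \<in> (\<Union>p\<in>{0..<L}. {x. (\<lambda>m. x (m + p)) \<in> B})"
    then show "x \<in> translates B" by (auto simp: translates_def)
  qed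
  moreover have "closedin cantor_top {x. (\<lambda>m. x (m + p)) \<in> B}" for p
    unfolding closedin_cantor_iff
  proof (intro allI impI CollectI)
    fix x assume x: "\<forall>n. \<exists>y\<in>{x. (\<lambda>m. x (m + p)) \<in> B}. agree n y x"
    show "(\<lambda>m. x (m + p)) \<in> B"
    proof (rule free_blocks_closed[OF assms])
      fix n
      obtain y where y: "(\<lambda>m. y (m + p)) \<in> B" "agree (n + \<bar>p\<bar>) y x" using x by blast
      have "agree n (\<lambda>m. y (m + p)) (\<lambda>m. x (m + p))"
        using y(2) abs_ge_self[of p] abs_ge_minus_self[of p] by (simp add: agree_def)
      with y(1) show "\<exists>y\<in>B. agree n y (\<lambda>m. x (m + p))" by blast
    qed
  qed
  then have "closedin cantor_top (\<Union>p\<in>{0..<L}. {x. (\<lambda>m. x (m + p)) \<in> B})"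
    by (intro closedin_Union) auto
  ultimately show ?thesis by simp
qed

section \<open>Refinement to longer blocks with a prescribed middle\<close>

lemma block_div_mod:
  fixes L N k j :: int
  assumes "0 < N" "0 \<le> j" "j < L"
  shows "k * L + j = (k div N) * (N * L) + ((k mod N) * L + j)"
    and "0 \<le> (k mod N) * L + j" and "(k mod N) * L + j < N * L"
    and "(k * L + j) mod (N * L) = (k mod N) * L + j"
proof -
  have "k * L = (k div N * N + k mod N) * L" by simp
  also have "\<dots> = k div N * (N * L) + k mod N * L" by (simp only: distrib_right mult.assoc)
  finally show eq: "k * L + j = (k div N) * (N * L) + ((k mod N) * L + j)"
    by (simp only: add.assoc)
  show ge: "0 \<le> (k mod N) * L + j" using assms by simp
  have "(k mod N + 1) * L \<le> N * L"
    using assms pos_mod_bound[of N k] by (intro mult_right_mono) linarith+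
  then show lt: "(k mod N) * L + j < N * L" using assms by (simp add: algebra_simps)
  show "(k * L + j) mod (N * L) = (k mod N) * L + j"
    unfolding eq using ge lt by simp
qed

text \<open>The \<open>M\<close> subblocks at either end of a new block stay free, so every window around the origin
  of a point of \<open>B\<close> survives the refinement if \<open>M\<close> is large.\<close>

definition refine :: "int \<Rightarrow> int \<Rightarrow> int \<Rightarrow> point \<Rightarrow> point set \<Rightarrow> point set" where
  "refine L M c g B = {x \<in> B. \<forall>k j. 0 \<le> j \<and> j < c * L \<longrightarrow>
     x (k * ((2 * M + c) * L) + (M * L + j)) = g j}"

text \<open>The way to push a point \<open>h\<close> of \<open>B\<close> into the refinement: the
  prescribed middle is written into every new block and the free ends are left as they are.\<close>

definition overwrite :: "int \<Rightarrow> int \<Rightarrow> int \<Rightarrow> point \<Rightarrow> point \<Rightarrow> point" where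
  "overwrite L M c g h = (\<lambda>m. let r = m mod ((2 * M + c) * L) in
     if M * L \<le> r \<and> r < (M + c) * L then g (r - M * L) else h m)"

lemma refine_subset: "refine L M c g B \<subseteq> B"
  by (auto simp: refine_def)

text \<open>The middle begins and ends at multiples of \<open>L\<close>, so no old block is cut. The
  old block numbered \<open>r\<close> inside its new block is block \<open>r - M\<close> of
  \<open>g\<close> if it belongs to the middle, and otherwise comes from \<open>h\<close>
  unchanged.\<close>

lemma overwrite_mem_refine:
  assumes B: "free_blocks L B" and g: "g \<in> B" and h: "h \<in> B" and M: "1 \<le> M" and c: "1 \<le> c"
  shows "overwrite L M c g h \<in> refine L M c g B"
proof -
  let ?x = "overwrite L M c g h"
  note L = free_blocks_pos[OF B]
  define N where "N = 2 * M + c"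
  have N: "0 < N" using M c by (simp add: N_def)
  have "?x \<in> B"
  proof (rule free_blocks_memI[OF B])
    fix k
    define r where "r = k mod N"
    have x: "?x (k * L + j) =
        (if M * L \<le> r * L + j \<and> r * L + j < (M + c) * L then g (r * L + j - M * L) else h (k * L + j))"
      if "0 \<le> j \<and> j < L" for j
      using that block_div_mod(4)[OF N, of j L k]
      by (simp add: overwrite_def Let_def r_def N_def)
    show "\<exists>b\<in>B. \<exists>k'. \<forall>j. 0 \<le> j \<and> j < L \<longrightarrow> ?x (k * L + j) = b (k' * L + j)"
    proof (cases "M \<le> r \<and> r < M + c")
      case True
      have "?x (k * L + j) = g ((r - M) * L + j)" if j: "0 \<le> j \<and> j < L" for j
      proof -
        have "M * L \<le> r * L" using True L by (intro mult_right_mono) auto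
        then have 1: "M * L \<le> r * L + j" using j by linarith
        have "(r + 1) * L \<le> (M + c) * L" using True L by (intro mult_right_mono) auto
        then have 2: "r * L + j < (M + c) * L" using j by (simp add: algebra_simps)
        have "(r - M) * L + j = r * L + j - M * L" by (simp add: algebra_simps)
        then show ?thesis by (simp only: x[OF j] 1 2 if_True simp_thms)
      qed
      with g show ?thesis by blast
    next
      case False
      have "?x (k * L + j) = h (k * L + j)" if j: "0 \<le> j \<and> j < L" for j
      proof (cases "M \<le> r")
        case True
        with False have "(M + c) * L \<le> r * L" using L by (intro mult_right_mono) auto
        then have "\<not> r * L + j < (M + c) * L" using j by linarith
        then show ?thesis by (simp only: x[OF j] if_False simp_thms)
      next
        case r: False
        then have "(r + 1) * L \<le> M * L" using L by (intro mult_right_mono) auto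
        then have "\<not> M * L \<le> r * L + j" using j by (simp add: algebra_simps)
        then show ?thesis by (simp only: x[OF j] if_False simp_thms)
      qed
      with h show ?thesis by blast
    qed
  qed
  moreover have "?x (k * (N * L) + (M * L + j)) = g j" if j: "0 \<le> j" "j < c * L" for k j
  proof -
    have "N * L = 2 * (M * L) + c * L" by (simp add: N_def algebra_simps)
    moreover have "0 < M * L" using M L by simp
    ultimately have "M * L + j < N * L" "0 \<le> M * L + j" using j by linarith+
    then have "(k * (N * L) + (M * L + j)) mod (N * L) = M * L + j" by simp
    then show ?thesis using j by (simp add: overwrite_def Let_def N_def algebra_simps)
  qed
  ultimately show ?thesis by (simp add: refine_def N_def)
qed

text \<open>The window of radius \<open>M * L\<close> consists of the right free end of the new
  block before the origin and the left free end of the one after it.\<close>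

lemma agree_overwrite:
  assumes L: "0 < L" and M: "1 \<le> M" and c: "1 \<le> c"
  shows "agree (M * L) h (overwrite L M c g h)"
  unfolding agree_def
proof (intro allI impI)
  fix m assume m: "- (M * L) \<le> m \<and> m < M * L"
  define P D where "P = M * L" and "D = (2 * M + c) * L"
  have D: "0 < P" "0 < c * L" "D = 2 * P + c * L" "(M + c) * L = P + c * L"
    using assms by (simp_all add: P_def D_def algebra_simps)
  have "\<not> (P \<le> m mod D \<and> m mod D < P + c * L)"
  proof (cases "0 \<le> m")
    case True
    then have "m mod D = m"
      using m D by (intro mod_pos_pos_trivial) (auto simp: P_def)
    then show ?thesis using m by (simp add: P_def)
  next
    case False
    have "m mod D = (m + D) mod D" by simp
    also have "\<dots> = m + D"
      using m D False unfolding P_def[symmetric] by (intro mod_pos_pos_trivial) linarith+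
    finally show ?thesis using m D unfolding P_def[symmetric] by simp
  qed
  then show "h m = overwrite L M c g h m"
    by (simp only: overwrite_def Let_def D(4) if_False simp_thms flip: P_def D_def)
qed

lemma free_blocks_refine:
  assumes B: "free_blocks L B" and M: "1 \<le> M" and c: "1 \<le> c"
  shows "free_blocks ((2 * M + c) * L) (refine L M c g B)"
proof -
  note L = free_blocks_pos[OF B]
  define N where "N = 2 * M + c"
  have N: "0 < N" using M c by (simp add: N_def)
  have "x \<in> refine L M c g B"
    if x: "\<And>k. \<exists>b\<in>refine L M c g B. \<exists>k'. \<forall>j. 0 \<le> j \<and> j < N * L \<longrightarrow> x (k * (N * L) + j) = b (k' * (N * L) + j)"
    for x
  proof -
    have "x \<in> B"
    proof (rule free_blocks_memI[OF B])
      fix k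
      obtain b k' where b: "b \<in> refine L M c g B"
        "\<And>j. 0 \<le> j \<and> j < N * L \<Longrightarrow> x ((k div N) * (N * L) + j) = b (k' * (N * L) + j)"
        using x[of "k div N"] by blast
      have "x (k * L + j) = b ((k' * N + k mod N) * L + j)" if j: "0 \<le> j \<and> j < L" for j
      proof -
        have "x (k * L + j) = x (k div N * (N * L) + ((k mod N) * L + j))"
          using block_div_mod(1)[OF N, of j L k] j by (simp only:)
        also have "\<dots> = b (k' * (N * L) + ((k mod N) * L + j))"
          using b(2) block_div_mod(2,3)[OF N, of j L k] j by blast
        also have "k' * (N * L) + ((k mod N) * L + j) = (k' * N + k mod N) * L + j"
          by (simp add: algebra_simps)
        finally show ?thesis .
      qed
      moreover have "b \<in> B" using b(1) refine_subset by blast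
      ultimately show "\<exists>b\<in>B. \<exists>k'. \<forall>j. 0 \<le> j \<and> j < L \<longrightarrow> x (k * L + j) = b (k' * L + j)"
        by blast
    qed
    moreover have "x (k * (N * L) + (M * L + j)) = g j" if j: "0 \<le> j \<and> j < c * L" for k j
    proof -
      obtain b k' where b: "b \<in> refine L M c g B"
        "\<And>j. 0 \<le> j \<and> j < N * L \<Longrightarrow> x (k * (N * L) + j) = b (k' * (N * L) + j)"
        using x[of k] by blast
      have "N * L = 2 * (M * L) + c * L" by (simp add: N_def algebra_simps)
      moreover have "0 < M * L" using M L by simp
      ultimately have "M * L + j < N * L" "0 \<le> M * L + j" using j by linarith+
      then have "x (k * (N * L) + (M * L + j)) = b (k' * (N * L) + (M * L + j))"
        using b(2) by simp
      also have "\<dots> = g j" using b(1) j by (simp add: refine_def N_def)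
      finally show ?thesis .
    qed
    ultimately show ?thesis by (simp add: refine_def N_def)
  qed
  moreover have "0 < N * L" using N L by simp
  ultimately show ?thesis unfolding free_blocks_def N_def[symmetric] by blast
qed

text \<open>An interval of twice the new block length contains a complete new block, wherever the
  blocks of \<open>y\<close> happen to be cut, and with it a copy of the middle.\<close>

lemma refine_syndetic:
  assumes "0 < L" "1 \<le> M" "1 \<le> c" and y: "y \<in> translates (refine L M c g B)"
  shows "\<exists>q. p \<le> q \<and> q + c * L \<le> p + 2 * ((2 * M + c) * L) \<and>
    (\<forall>j. 0 \<le> j \<and> j < c * L \<longrightarrow> y (q + j) = g j)"
proof -
  define D where "D = (2 * M + c) * L"
  have D: "D = 2 * (M * L) + c * L" "0 < M * L" "0 < c * L"
    using assms by (auto simp: D_def algebra_simps)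
  obtain s where s: "(\<lambda>m. y (m + s)) \<in> refine L M c g B"
    using y by (auto simp: translates_def)
  \<comment> \<open>The new block \<open>k\<close> is the first one that starts strictly after
    \<open>p\<close>, once the offset \<open>s\<close> of \<open>y\<close> is taken into
    account.\<close>
  define k where "k = (p - s) div D + 1"
  define q where "q = k * D + M * L + s"
  have "(p - s) div D * D + (p - s) mod D = p - s" by simp
  moreover have "0 \<le> (p - s) mod D" "(p - s) mod D < D" using D by simp_all
  moreover have "k * D = (p - s) div D * D + D" by (simp only: k_def distrib_right mult_1)
  ultimately have kD: "p - s < k * D" "k * D \<le> p - s + D" by linarith+
  have "y (q + j) = g j" if "0 \<le> j \<and> j < c * L" for j
  proof -
    have "y (k * D + (M * L + j) + s) = g j"
      using s that by (simp add: refine_def D_def)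
    then show ?thesis by (simp add: q_def algebra_simps)
  qed
  moreover have "p \<le> q" "q + c * L \<le> p + 2 * D" unfolding q_def using kD D by linarith+
  ultimately show ?thesis unfolding D_def by blast
qed

text \<open>There are only finitely many binary words of length \<open>2 * L\<close>. So one stretch
  of \<open>c\<close> blocks can list all adjacent pairs from \<open>B\<close> one after another and
  then \<open>K\<close> copies of the block of \<open>a\<close> at the origin.\<close>

lemma universal_point:
  assumes B: "free_blocks L B" and a: "a \<in> B" and K: "0 \<le> K"
  shows "\<exists>g\<in>B. \<exists>c\<ge>1.
    (\<forall>x\<in>B. \<forall>k. \<exists>r\<ge>0. r + 2 * L \<le> c * L \<and> (\<forall>j. 0 \<le> j \<and> j < 2 * L \<longrightarrow> g (r + j) = x (k * L + j))) \<and>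
    (\<exists>r\<ge>0. r + K * L \<le> c * L \<and> (\<forall>j. 0 \<le> j \<and> j < K * L \<longrightarrow> g (r + j) = a (j mod L)))"
proof -
  note L = free_blocks_pos[OF B]
  \<comment> \<open>\<open>pat x\<close> codes the pair of blocks of \<open>x\<close> at positions
    \<open>0\<close> to \<open>2 * L - 1\<close> by its set of true positions. Shifts by whole
    blocks bring every other pair there.\<close>
  define pat where "pat x = {j \<in> {0..<2 * L}. x j}" for x :: point
  have "finite (pat ` B)"
    by (rule finite_subset[of _ "Pow {0..<2 * L}"]) (auto simp: pat_def)
  then obtain F where F: "F \<subseteq> B" "finite F" "pat ` B = pat ` F"
    using finite_subset_image[of "pat ` B" pat B] by blast
  obtain ps where ps: "set ps = F" using finite_list[OF F(2)] by blast
  define n where "n = int (length ps)"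
  define g :: point where "g m = (if 0 \<le> m \<and> m < 2 * L * n
      then (ps ! nat (m div (2 * L))) (m mod (2 * L)) else a (m mod L))" for m
  \<comment> \<open>Two blocks for each listed pair and \<open>K\<close> for the power; the summand
    \<open>1\<close> makes \<open>1 \<le> c\<close> immediate.\<close>
  define c where "c = 2 * n + K + 1"
  have "g \<in> B"
  proof (rule free_blocks_memI[OF B])
    fix k
    show "\<exists>b\<in>B. \<exists>k'. \<forall>j. 0 \<le> j \<and> j < L \<longrightarrow> g (k * L + j) = b (k' * L + j)"
    proof (cases "0 \<le> k \<and> k < 2 * n")
      case True
      have "nat (k div 2) < length ps" using True by (auto simp: n_def)
      then have "ps ! nat (k div 2) \<in> B" using ps F(1) nth_mem by blast
      moreover have "g (k * L + j) = (ps ! nat (k div 2)) ((k mod 2) * L + j)"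
        if j: "0 \<le> j \<and> j < L" for j
      proof -
        note bd = block_div_mod[of 2 j L k]
        have "(k + 1) * L \<le> (2 * n) * L" using True L by (intro mult_right_mono) auto
        then have "k * L + j < 2 * L * n" using j by (simp add: algebra_simps)
        moreover have "0 \<le> k * L + j" using True L j by simp
        moreover have "k * L + j = 2 * L * (k div 2) + ((k mod 2) * L + j)"
          using bd(1) j by (simp only: mult.commute[of "2 * L"])
        then have "(k * L + j) div (2 * L) = k div 2"
          using bd(2,3) j by (intro int_div_pos_eq) simp_all
        ultimately show ?thesis using bd(4) j by (simp add: g_def)
      qed
      ultimately show ?thesis by blast
    next
      case False
      have "g (k * L + j) = a (0 * L + j)" if j: "0 \<le> j \<and> j < L" for j
      proof -
        have "\<not> (0 \<le> k * L + j \<and> k * L + j < 2 * L * n)"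
        proof (cases "0 \<le> k")
          case True
          with False have "(2 * n) * L \<le> k * L" using L by (intro mult_right_mono) auto
          then have "2 * L * n \<le> k * L" by (simp only: ac_simps)
          then show ?thesis using j by linarith
        next
          case False
          then have "(k + 1) * L \<le> 0 * L" using L by (intro mult_right_mono) auto
          then show ?thesis using j by (simp add: algebra_simps)
        qed
        then show ?thesis using j by (auto simp: g_def)
      qed
      with a show ?thesis by blast
    qed
  qed
  moreover have "1 \<le> c" using K by (simp add: c_def n_def)
  moreover have "\<exists>r\<ge>0. r + 2 * L \<le> c * L \<and> (\<forall>j. 0 \<le> j \<and> j < 2 * L \<longrightarrow> g (r + j) = x (k * L + j))"
    if x: "x \<in> B" for x k
  proof -
    have "(\<lambda>m. x (m + k * L)) \<in> B" by (rule free_blocks_shift[OF B x])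
    then obtain f where f: "f \<in> F" "pat (\<lambda>m. x (m + k * L)) = pat f" using F(3) by blast
    obtain i where i: "i < length ps" "ps ! i = f" using f(1) ps by (metis in_set_conv_nth)
    have fx: "f j = x (k * L + j)" if "0 \<le> j \<and> j < 2 * L" for j
    proof -
      have "j \<in> pat (\<lambda>m. x (m + k * L)) \<longleftrightarrow> j \<in> pat f" using f(2) by simp
      then show ?thesis using that by (simp add: pat_def add.commute)
    qed
    have le: "2 * L * int i + 2 * L \<le> 2 * L * n"
    proof -
      have "2 * L * (int i + 1) \<le> 2 * L * n" using i(1) L by (intro mult_left_mono) (auto simp: n_def)
      then show ?thesis by (simp add: algebra_simps)
    qed
    have "g (2 * L * int i + j) = f j" if j: "0 \<le> j \<and> j < 2 * L" for j
    proof -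
      have "(2 * L * int i + j) div (2 * L) = int i"
        using j by (intro int_div_pos_eq[of _ _ _ j]) auto
      moreover have "(2 * L * int i + j) mod (2 * L) = j" using j by simp
      moreover have "0 \<le> 2 * L * int i + j" "2 * L * int i + j < 2 * L * n" using j le L by auto
      ultimately show ?thesis using i(2) by (simp add: g_def)
    qed
    moreover have "2 * L * int i + 2 * L \<le> c * L"
    proof -
      have "c * L = 2 * L * n + K * L + L" by (simp add: c_def algebra_simps)
      then show ?thesis using le L mult_nonneg_nonneg[of K L] K by linarith
    qed
    moreover have "0 \<le> 2 * L * int i" using L by simp
    ultimately show ?thesis using fx by (intro exI[of _ "2 * L * int i"]) simp
  qed
  moreover have "\<exists>r\<ge>0. r + K * L \<le> c * L \<and> (\<forall>j. 0 \<le> j \<and> j < K * L \<longrightarrow> g (r + j) = a (j mod L))"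
  proof (intro exI conjI allI impI)
    show "0 \<le> 2 * L * n" using L by (simp add: n_def)
    show "2 * L * n + K * L \<le> c * L" using L by (simp add: c_def algebra_simps)
    fix j assume "0 \<le> j \<and> j < K * L"
    moreover have "(2 * L * n + j) mod L = j mod L"
      by (metis mod_mult_self4 mult.assoc mult.commute)
    ultimately show "g (2 * L * n + j) = a (j mod L)" by (simp add: g_def)
  qed
  ultimately show ?thesis by blast
qed

section \<open>The forcing conditions\<close>

text \<open>The point \<open>u i\<close> matters only through its window \<open>{-L..<L}\<close>, which consists of one block on either
  side of the origin.\<close>

type_synonym 'i cond = "int \<times> point set \<times> ('i \<Rightarrow> point)"

text \<open>The clause on \<open>x\<close> and \<open>y\<close> provides two different words. With a
  single word, \<open>B\<close> would consist of one periodic point, which no extension could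
  omit.\<close>

fun condition :: "'i cond \<Rightarrow> bool" where
  "condition (L, B, u) \<longleftrightarrow> free_blocks L B \<and>
     (\<exists>x\<in>B. \<exists>y\<in>B. \<exists>j. 0 \<le> j \<and> j < L \<and> x j \<noteq> y j) \<and> (\<forall>i. u i \<in> B)"

fun extends :: "'i cond \<Rightarrow> 'i cond \<Rightarrow> bool" where
  "extends (L, B, u) (L', B', u') \<longleftrightarrow> L \<le> L' \<and> B' \<subseteq> B \<and> (\<forall>i. agree L (u i) (u' i))"

text \<open>The source of minimality. Pairs of blocks are used because an interval of length at most
  \<open>L\<close>, wherever it lies, is covered by two adjacent blocks.\<close>

fun links :: "'i cond \<Rightarrow> 'j cond \<Rightarrow> bool" where
  "links (L, B, u) (L', B', u') \<longleftrightarrow> 2 * L \<le> L' \<and>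
     (\<forall>x\<in>B. \<forall>y\<in>B'. \<forall>k. \<exists>q. \<forall>j. 0 \<le> j \<and> j < 2 * L \<longrightarrow> y (q + j) = x (k * L + j))"

text \<open>At a finite stage the final points and their common outputs are known only to lie in
  these sets. The sets shrink under \<open>extends\<close>, so a requirement once met stays
  met.\<close>

fun avoids where
  "avoids F G s t (L, B, u) \<longleftrightarrow> \<not> (\<exists>x\<in>B. \<exists>x'\<in>B. \<exists>y\<in>translates B.
     agree L (u s) x \<and> agree L (u t) x' \<and> maps_to F x y \<and> maps_to G x' y)"

lemma extends_refl: "extends p p"
  by (cases p) simp

lemma extends_trans: "extends p q \<Longrightarrow> extends q r \<Longrightarrow> extends p r"
  by (cases p; cases q; cases r) (force intro: agree_trans agree_mono)

lemma links_extends: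
  assumes "links p q" "extends q r"
  shows "links p r"
proof -
  obtain L B u L' B' u' L'' B'' u'' where
    e: "p = (L, B, u)" "q = (L', B', u')" "r = (L'', B'', u'')"
    by (cases p; cases q; cases r) blast
  have "2 * L \<le> L''" "B'' \<subseteq> B'" using assms by (simp_all add: e)
  then show ?thesis using assms(1) unfolding e links.simps by blast
qed

lemma avoids_extends:
  assumes "avoids F G s t p" "extends p q"
  shows "avoids F G s t q"
proof -
  obtain L B u L' B' u' where p: "p = (L, B, u)" and q: "q = (L', B', u')"
    by (cases p; cases q) auto
  have "agree L (u i) x" if "agree L' (u' i) x" for i x
    using assms(2) agree_trans[OF _ agree_mono[OF that], of L "u i"] by (simp add: p q)
  moreover have "B' \<subseteq> B" using assms(2) by (simp add: p q)
  ultimately show ?thesis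
    using assms(1) translates_mono[of B' B] unfolding p q avoids.simps by blast
qed

section \<open>Extensions that meet the requirements\<close>

lemma condition_refine:
  assumes p: "condition (L, B, u)" and g: "g \<in> B" and M: "1 \<le> M" and c: "1 \<le> c"
    and h: "\<And>i. h i \<in> B" "\<And>i. agree L (u i) (h i)"
  defines "q \<equiv> ((2 * M + c) * L, refine L M c g B, \<lambda>i. overwrite L M c g (h i))"
  shows "condition q" and "extends (L, B, u) q" and "2 * L \<le> (2 * M + c) * L"
    and "M * L \<le> (2 * M + c) * L"
proof -
  have B: "free_blocks L B" using p by simp
  note L = free_blocks_pos[OF B]
  have LM: "L \<le> M * L" using M L mult_right_mono[of 1 M L] by simp
  have "0 < c * L" using c L by simp
  moreover have D: "(2 * M + c) * L = 2 * (M * L) + c * L" by (simp add: algebra_simps)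
  ultimately show 2: "2 * L \<le> (2 * M + c) * L" and 3: "M * L \<le> (2 * M + c) * L"
    using LM L by linarith+
  obtain x y j where xy: "x \<in> B" "y \<in> B" "0 \<le> j" "j < L" "x j \<noteq> y j" using p by auto
  have "- (M * L) \<le> j \<and> j < M * L" using xy(3,4) LM L by linarith
  \<comment> \<open>Position \<open>j\<close> lies in a free end, so the two points still differ
    there after overwriting, as \<open>condition\<close> demands.\<close>
  then have keep: "overwrite L M c g h' j = h' j" for h'
    using agree_overwrite[OF L M c, of h' g] unfolding agree_def by metis
  have "j < (2 * M + c) * L" using 2 L xy(4) by linarith
  moreover have "overwrite L M c g x j \<noteq> overwrite L M c g y j" using xy(5) by (simp only: keep not_False_eq_True)
  ultimately have "\<exists>x\<in>refine L M c g B. \<exists>y\<in>refine L M c g B. \<exists>j. 0 \<le> j \<and> j < (2 * M + c) * L \<and> x j \<noteq> y j"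
    using xy(3) overwrite_mem_refine[OF B g xy(1) M c] overwrite_mem_refine[OF B g xy(2) M c] by blast
  then show "condition q"
    using overwrite_mem_refine[OF B g h(1) M c] free_blocks_refine[OF B M c]
    by (simp add: q_def)
  have "agree L (u i) (overwrite L M c g (h i))" for i
    using h(2) agree_mono[OF agree_overwrite[OF L M c] LM] by (rule agree_trans)
  then show "extends (L, B, u) q"
    using 2 L refine_subset by (simp add: q_def)
qed

text \<open>With a universal \<open>g\<close> as middle, every new block, hence every point of the
  refinement, contains all pairs of adjacent old blocks.\<close>

lemma ex_linked_extension:
  assumes "condition p"
  shows "\<exists>q. condition q \<and> extends p q \<and> links p q"
proof -
  obtain L B u where p: "p = (L, B, u)" by (cases p)
  have B: "free_blocks L B" and u: "\<And>i. u i \<in> B" using assms by (simp_all add: p)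
  obtain g c where g: "g \<in> B" "1 \<le> c" and pairs: "\<And>x k. x \<in> B \<Longrightarrow>
      \<exists>r\<ge>0. r + 2 * L \<le> c * L \<and> (\<forall>j. 0 \<le> j \<and> j < 2 * L \<longrightarrow> g (r + j) = x (k * L + j))"
    using universal_point[OF B u[of undefined] order_refl] by blast
  note q = condition_refine[OF assms[unfolded p] g(1) order_refl g(2) u agree_refl]
  have "\<exists>q. \<forall>j. 0 \<le> j \<and> j < 2 * L \<longrightarrow> y (q + j) = x (k * L + j)"
    if x: "x \<in> B" and y: "y \<in> refine L 1 c g B" for x y k
  proof -
    obtain r where r: "0 \<le> r" "r + 2 * L \<le> c * L"
      "\<And>j. 0 \<le> j \<and> j < 2 * L \<Longrightarrow> g (r + j) = x (k * L + j)"
      using pairs[OF x] by blast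
    have "y (L + r + j) = x (k * L + j)" if j: "0 \<le> j \<and> j < 2 * L" for j
    proof -
      have "\<forall>j. 0 \<le> j \<and> j < c * L \<longrightarrow> y (0 * ((2 * 1 + c) * L) + (1 * L + j)) = g j"
        using y unfolding refine_def by blast
      then have "y (L + (r + j)) = g (r + j)" using r j by simp
      then show ?thesis using r(3)[OF j] by (simp add: add.assoc)
    qed
    then show ?thesis by blast
  qed
  with q(3) have "links p ((2 * 1 + c) * L, refine L 1 c g B, \<lambda>i. overwrite L 1 c g (u i))"
    by (simp add: p)
  with q(1,2) show ?thesis unfolding p by blast
qed

text \<open>Fix a block \<open>a\<close>. If \<open>y\<close> omits some power \<open>a\<^sup>K\<close>, then insert \<open>a\<^sup>K\<close> into all new blocks. Otherwise
  \<open>y\<close> has arbitrarily long stretches of period \<open>L\<close>, whereas the new blocks contain two distinct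
  adjacent blocks.\<close>

lemma ex_extension_omitting:
  assumes "condition p"
  shows "\<exists>q. condition q \<and> extends p q \<and> y \<notin> translates (fst (snd q))"
proof -
  obtain L B u where p: "p = (L, B, u)" by (cases p)
  have B: "free_blocks L B" and u: "\<And>i. u i \<in> B" using assms by (simp_all add: p)
  note L = free_blocks_pos[OF B]
  obtain x0 x1 j0 where x01: "x0 \<in> B" "x1 \<in> B" "0 \<le> j0" "j0 < L" "x0 j0 \<noteq> x1 j0"
    using assms by (auto simp: p)
  define repeats where
    "repeats K \<longleftrightarrow> (\<exists>p. \<forall>j. 0 \<le> j \<and> j < K * L \<longrightarrow> y (p + j) = x0 (j mod L))" for K
  \<comment> \<open>\<open>K\<close> is an exponent that \<open>y\<close> omits, if there is one; it
    has to be known before \<open>g\<close> is built.\<close>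
  obtain K where K: "0 \<le> K" "\<not> repeats K \<or> (\<forall>K\<ge>0. repeats K)" by (metis order_refl)
  obtain g c where g: "g \<in> B" "1 \<le> c" and pairs: "\<And>x k. x \<in> B \<Longrightarrow>
      \<exists>r\<ge>0. r + 2 * L \<le> c * L \<and> (\<forall>j. 0 \<le> j \<and> j < 2 * L \<longrightarrow> g (r + j) = x (k * L + j))"
    and power: "\<exists>r\<ge>0. r + K * L \<le> c * L \<and> (\<forall>j. 0 \<le> j \<and> j < K * L \<longrightarrow> g (r + j) = x0 (j mod L))"
    using universal_point[OF B x01(1) K(1)] by blast
  note q = condition_refine[OF assms[unfolded p] g(1) order_refl g(2) u agree_refl]
  have "y \<notin> translates (refine L 1 c g B)"
  proof
    assume y: "y \<in> translates (refine L 1 c g B)"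
    note syn = refine_syndetic[OF L order_refl g(2) y]
    from K(2) show False
    proof
      assume "\<not> repeats K"
      obtain q where q: "\<And>j. 0 \<le> j \<and> j < c * L \<Longrightarrow> y (q + j) = g j" using syn by blast
      obtain r where r: "0 \<le> r" "r + K * L \<le> c * L"
        "\<And>j. 0 \<le> j \<and> j < K * L \<Longrightarrow> g (r + j) = x0 (j mod L)" using power by blast
      have "y (q + r + j) = x0 (j mod L)" if "0 \<le> j \<and> j < K * L" for j
        using q[of "r + j"] r that by (simp add: add.assoc)
      with \<open>\<not> repeats K\<close> show False unfolding repeats_def by blast
    next
      assume "\<forall>K\<ge>0. repeats K"
      moreover have "0 \<le> 2 * (2 * 1 + c)" using g(2) by simp
      \<comment> \<open>This periodic stretch has twice the new block length, so by
        \<open>syn\<close> it contains a whole copy of the middle.\<close>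
      ultimately have "repeats (2 * (2 * 1 + c))" by blast
      then obtain i where
        i: "\<And>j. 0 \<le> j \<and> j < 2 * ((2 * 1 + c) * L) \<Longrightarrow> y (i + j) = x0 (j mod L)"
        unfolding repeats_def mult.assoc by blast
      obtain q where q: "i \<le> q" "q + c * L \<le> i + 2 * ((2 * 1 + c) * L)"
        "\<And>j. 0 \<le> j \<and> j < c * L \<Longrightarrow> y (q + j) = g j" using syn by blast
      \<comment> \<open>\<open>w\<close> has the origin block of \<open>x0\<close> at block
        \<open>0\<close> and that of \<open>x1\<close> at block \<open>1\<close>, so this pair of
        different words occurs in \<open>g\<close>.\<close>
      define w :: point where "w m = (if m < L then x0 m else x1 (m - L))" for m
      have "w \<in> B"
      proof (rule free_blocks_memI[OF B])
        fix k
        show "\<exists>b\<in>B. \<exists>k'. \<forall>j. 0 \<le> j \<and> j < L \<longrightarrow> w (k * L + j) = b (k' * L + j)"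
        proof (cases "k \<le> 0")
          case True
          then have "k * L \<le> 0" using L by (simp add: mult_le_0_iff)
          then have "w (k * L + j) = x0 (k * L + j)" if "0 \<le> j \<and> j < L" for j
            using that by (simp add: w_def)
          with x01(1) show ?thesis by blast
        next
          case False
          then have "1 * L \<le> k * L" using L by (intro mult_right_mono) auto
          then have "\<not> k * L + j < L" if "0 \<le> j \<and> j < L" for j
            using that by linarith
          moreover have "(k - 1) * L + j = k * L + j - L" for j by (simp add: algebra_simps)
          ultimately have "w (k * L + j) = x1 ((k - 1) * L + j)" if "0 \<le> j \<and> j < L" for j
            using that by (simp only: w_def if_False)
          with x01(2) show ?thesis by blast
        qed
      qed
      then obtain r where r: "0 \<le> r" "r + 2 * L \<le> c * L"
        "\<And>j. 0 \<le> j \<and> j < 2 * L \<Longrightarrow> g (r + j) = w (0 * L + j)" using pairs by blast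
      \<comment> \<open>\<open>d\<close> is the place of \<open>j0\<close> in the copy of the
        \<open>x0\<close> block, counted from \<open>i\<close>. Periodicity equates the values at
        \<open>d\<close> and \<open>d + L\<close>, whereas \<open>g\<close> has \<open>x0 j0\<close>
        and \<open>x1 j0\<close> there.\<close>
      define d where "d = q - i + r + j0"
      have d: "0 \<le> d" "d + L < 2 * ((2 * 1 + c) * L)"
        using q(1,2) r(1,2) x01(3,4) L unfolding d_def by linarith+
      have "x0 j0 = g (r + j0)" using r(3)[of j0] x01 by (simp add: w_def)
      also have "\<dots> = y (q + (r + j0))" using q(3)[of "r + j0"] r(1,2) x01 by simp
      also have "\<dots> = y (i + d)" by (simp add: d_def algebra_simps)
      also have "\<dots> = x0 (d mod L)" using i[of d] d L by simp
      also have "\<dots> = x0 ((d + L) mod L)" by simp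
      also have "\<dots> = y (i + (d + L))" using i[of "d + L"] d L by simp
      also have "\<dots> = y (q + (r + (j0 + L)))" by (simp add: d_def algebra_simps)
      also have "\<dots> = g (r + (j0 + L))" using q(3)[of "r + (j0 + L)"] r(1,2) x01 by simp
      also have "\<dots> = x1 j0" using r(3)[of "j0 + L"] x01 by (simp add: w_def)
      finally show False using x01(5) by simp
    qed
  qed
  then show ?thesis unfolding p using q(1,2)
    by (intro exI[of _ "((2 * 1 + c) * L, refine L 1 c g B, \<lambda>i. overwrite L 1 c g (u i))"])
      (simp only: fst_conv snd_conv simp_thms)
qed

text \<open>If no extension makes the two computations disagree, then they have at most one common
  output, and it suffices to omit that output.\<close>

lemma ex_avoiding_extension:
  assumes p: "condition p" and st: "s \<noteq> t"
    and F: "continuous_functional F" and G: "continuous_functional G"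
  shows "\<exists>q. condition q \<and> extends p q \<and> avoids F G s t q"
proof -
  obtain L B u where pe: "p = (L, B, u)" by (cases p)
  have B: "free_blocks L B" and u: "\<And>i. u i \<in> B" using p by (simp_all add: pe)
  note L = free_blocks_pos[OF B]
  show ?thesis
  proof (cases "\<exists>x\<in>B. \<exists>x'\<in>B. \<exists>n v v'. agree L (u s) x \<and> agree L (u t) x' \<and>
      F x n = Some v \<and> G x' n = Some v' \<and> v \<noteq> v'")
    case True
    then obtain x x' n v v' where x: "x \<in> B" "agree L (u s) x" "F x n = Some v"
      and x': "x' \<in> B" "agree L (u t) x'" "G x' n = Some v'" and v: "v \<noteq> v'" by blast
    obtain N N' where N: "\<And>z. agree N x z \<Longrightarrow> F z n = Some v"
      and N': "\<And>z. agree N' x' z \<Longrightarrow> G z n = Some v'"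
      using F G x(3) x'(3) unfolding continuous_functional_def by metis
    \<comment> \<open>The free ends are made long enough to preserve the parts of \<open>x\<close>
      and \<open>x'\<close> on which the two different values depend.\<close>
    define M where "M = max 1 (max N N')"
    have M: "1 \<le> M" "N \<le> M" "N' \<le> M" by (simp_all add: M_def)
    have "M * 1 \<le> M * L" using M L by (intro mult_left_mono) auto
    then have LM: "N \<le> M * L" "N' \<le> M * L" using M by linarith+
    \<comment> \<open>As \<open>s\<close> and \<open>t\<close> are different nodes, both points can
      be replaced at once.\<close>
    define h where "h = u(s := x, t := x')"
    have h: "h i \<in> B" "agree L (u i) (h i)" for i
      using u x(1,2) x'(1,2) by (auto simp: h_def)
    note q = condition_refine[OF p[unfolded pe] u[of s] M(1) order_refl h]
    have far: "agree (M * L) (h i) z"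
      if "agree ((2 * M + 1) * L) (overwrite L M 1 (u s) (h i)) z" for i z
      using agree_overwrite[OF L M(1) order_refl] agree_mono[OF that q(4)] by (rule agree_trans)
    have "avoids F G s t ((2 * M + 1) * L, refine L M 1 (u s) B, \<lambda>i. overwrite L M 1 (u s) (h i))"
      unfolding avoids.simps
    proof safe
      fix z z' y
      assume z: "agree ((2 * M + 1) * L) (overwrite L M 1 (u s) (h s)) z"
        "agree ((2 * M + 1) * L) (overwrite L M 1 (u s) (h t)) z'"
        and y: "maps_to F z y" "maps_to G z' y"
      have "F z n = Some v" using N agree_mono[OF far[OF z(1)] LM(1)] st by (simp add: h_def)
      moreover have "G z' n = Some v'" using N' agree_mono[OF far[OF z(2)] LM(2)] by (simp add: h_def)
      ultimately show False using y v by (simp add: maps_to_def)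
    qed
    with q(1,2) show ?thesis unfolding pe by blast
  next
    case False
    then have same: "v = v'" if "x \<in> B" "x' \<in> B" "agree L (u s) x" "agree L (u t) x'"
      "F x n = Some v" "G x' n = Some v'" for x x' n v v' using that by blast
    show ?thesis
    proof (cases "avoids F G s t p")
      case True
      then show ?thesis using p extends_refl by blast
    next
      case False
      then obtain x' y where x': "x' \<in> B" "agree L (u t) x'" "maps_to G x' y"
        by (auto simp: pe)
      \<comment> \<open>Omitting this one \<open>y\<close> suffices: any common output
        \<open>y'\<close> is an output of \<open>F\<close> above \<open>s\<close>, and comparing
        that computation with the one of \<open>G\<close> at the fixed \<open>x'\<close> gives
        \<open>y' = y\<close>.\<close>
      obtain q where q: "condition q" "extends p q" "y \<notin> translates (fst (snd q))"
        using ex_extension_omitting[OF p] by blast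
      obtain L' B' u' where qe: "q = (L', B', u')" by (cases q)
      have "avoids F G s t q" unfolding qe avoids.simps
      proof safe
        fix x z y'
        assume x: "x \<in> B'" "agree L' (u' s) x" "maps_to F x y'" and y': "y' \<in> translates B'"
        have "agree L (u s) x" "x \<in> B"
          using q(2) x(1) agree_trans[OF _ agree_mono[OF x(2)]] by (auto simp: pe qe)
        then have "point_seq y' n = point_seq y n" for n
          using same x' x(3) unfolding maps_to_def by blast
        then have "y' = y" using point_seq_inject by blast
        with y' q(3) show False by (simp add: qe)
      qed
      with q(1,2) show ?thesis by blast
    qed
  qed
qed

text \<open>The pairs are treated one after another; what has been achieved persists under further
  extension.\<close>

lemma ex_stage:
  assumes p: "condition p" and P: "finite P" "\<forall>e\<in>P. fst e \<noteq> snd e"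
    and F: "continuous_functional F" and G: "continuous_functional G"
  shows "\<exists>q. condition q \<and> extends p q \<and> links p q \<and> (\<forall>e\<in>P. avoids F G (fst e) (snd e) q)"
  using P
proof (induction P rule: finite_induct)
  case empty
  then show ?case using ex_linked_extension[OF p] by simp
next
  case (insert e P)
  from insert.prems have "\<forall>e\<in>P. fst e \<noteq> snd e" and ne: "fst e \<noteq> snd e" by simp_all
  from insert.IH[OF this(1)]
  obtain q where q: "condition q" "extends p q" "links p q"
    and P: "\<forall>e\<in>P. avoids F G (fst e) (snd e) q" by (elim exE conjE)
  from ex_avoiding_extension[OF q(1) ne F G]
  obtain r where r: "condition r" "extends q r" "avoids F G (fst e) (snd e) r" by (elim exE conjE)
  have "avoids F G (fst e') (snd e') r" if "e' \<in> P" for e'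
    using P that by (intro avoids_extends[OF _ r(2)]) (rule bspec)
  with r(3) have "\<forall>e\<in>insert e P. avoids F G (fst e) (snd e) r" by simp
  with r(1) extends_trans[OF q(2) r(2)] links_extends[OF q(3) r(2)]
  show ?case by (intro exI[of _ r] conjI)
qed

section \<open>The subshift and the points\<close>

lemma subshift_translate:
  assumes "subshift Y" "y \<in> Y"
  shows "(\<lambda>m. y (m + s)) \<in> Y"
proof (induction s rule: int_induct[of _ 0])
  case base
  show ?case using assms(2) by simp
next
  case (step1 i)
  then have "shift (\<lambda>m. y (m + i)) \<in> Y" using assms(1) unfolding subshift_def by blast
  then show ?case by (simp add: shift_def algebra_simps)
next
  case (step2 i)
  then have "shift_inv (\<lambda>m. y (m + i)) \<in> Y" using assms(1) unfolding subshift_def by blast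
  then show ?case by (simp add: shift_inv_def algebra_simps)
qed

text \<open>The third premise puts \<open>w\<close> into the closure of the orbit of
  \<open>y\<close>, and every subshift containing \<open>y\<close> contains that closure.\<close>

lemma minimal_subshiftI:
  assumes "subshift X" "X \<noteq> {}"
    and "\<And>w y N. w \<in> X \<Longrightarrow> y \<in> X \<Longrightarrow> \<exists>s. agree N (\<lambda>m. y (m + s)) w"
  shows "minimal_subshift X"
proof -
  have "X \<subseteq> Y" if Y: "subshift Y" "Y \<noteq> {}" "Y \<subseteq> X" for Y
  proof
    fix w assume w: "w \<in> X"
    obtain y where y: "y \<in> Y" using Y by blast
    have "\<exists>y\<in>Y. agree N y w" for N
      using assms(3)[OF w] y Y subshift_translate[OF Y(1) y] by blast
    then show "w \<in> Y" using Y(1) unfolding subshift_def closedin_cantor_iff by blast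
  qed
  then show ?thesis using assms(1,2) unfolding minimal_subshift_def by blast
qed

section \<open>The sequence of stages and its bookkeeping\<close>

definition requirement :: "nat \<Rightarrow> code \<times> code" where
  "requirement n = from_nat (fst (prod_decode n))"

text \<open>Each pair of programs must come up again after any stage, because two branches may
  separate arbitrarily late.\<close>

lemma requirement_recurs: "\<exists>n\<ge>N. requirement n = e"
  by (intro exI[of _ "prod_encode (to_nat e, N)"])
    (simp add: requirement_def le_prod_encode_2)

lemma ex_generic_sequence:
  obtains L :: "nat \<Rightarrow> int" and B :: "nat \<Rightarrow> point set" and u :: "nat \<Rightarrow> bool list \<Rightarrow> point"
  where "\<And>n. free_blocks (L n) (B n)" "\<And>n i. u n i \<in> B n"
    "\<And>n. B (Suc n) \<subseteq> B n" "\<And>n i. agree (L n) (u n (butlast i)) (u (Suc n) i)"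
    "\<And>n. 2 * L n \<le> L (Suc n)"
    "\<And>n x y k. x \<in> B n \<Longrightarrow> y \<in> B (Suc n) \<Longrightarrow>
       \<exists>q. \<forall>j. 0 \<le> j \<and> j < 2 * L n \<longrightarrow> y (q + j) = x (k * L n + j)"
    "\<And>n s t c d. requirement n = (c, d) \<Longrightarrow> length s = Suc n \<Longrightarrow> length t = Suc n \<Longrightarrow> s \<noteq> t \<Longrightarrow>
       avoids (program c) (program d) s t (L (Suc n), B (Suc n), u (Suc n))"
proof -
  \<comment> \<open>Words of length \<open>n\<close> are the nodes of stage \<open>n\<close>. Before
    a stage is carried out, each child inherits the point of its parent, so siblings start out
    equal.\<close>
  define reindex :: "bool list cond \<Rightarrow> bool list cond"
    where "reindex = (\<lambda>(L, B, u). (L, B, u \<circ> butlast))"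
  define good where "good n p q \<longleftrightarrow> extends (reindex p) q \<and> links (reindex p) q \<and>
    (\<forall>e\<in>{(s, t). length s = Suc n \<and> length t = Suc n \<and> s \<noteq> t}.
       avoids (program (fst (requirement n))) (program (snd (requirement n))) (fst e) (snd e) q)"
    for n and p q :: "bool list cond"
  have "\<exists>(x :: point) y j. 0 \<le> j \<and> j < (1 :: int) \<and> x j \<noteq> y j"
    by (intro exI[of _ "\<lambda>_. True"] exI[of _ "\<lambda>_. False"] exI[of _ 0]) simp
  \<comment> \<open>The construction starts from the full shift, with blocks of length
    \<open>1\<close>.\<close>
  then have "condition (1, UNIV, \<lambda>i m. False)" by (simp add: free_blocks_def)
  moreover have "\<exists>q. condition q \<and> good n p q" if p: "condition p" for p n
  proof -
    have "condition (reindex p)" using p by (cases p) (simp add: reindex_def)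
    moreover have "finite {(s, t). length s = Suc n \<and> length t = Suc n \<and> (s :: bool list) \<noteq> t}"
      by (rule finite_subset[of _ "{s. set s \<subseteq> UNIV \<and> length s = Suc n} \<times> {s. set s \<subseteq> UNIV \<and> length s = Suc n}"])
        (use finite_lists_length_eq[of "UNIV :: bool set"] in auto)
    moreover have "\<forall>e\<in>{(s, t). length s = Suc n \<and> length t = Suc n \<and> (s :: bool list) \<noteq> t}. fst e \<noteq> snd e"
      by auto
    ultimately show ?thesis
      unfolding good_def by (rule ex_stage[OF _ _ _ continuous_program continuous_program])
  qed
  ultimately obtain p where p: "\<And>n. condition (p n)" "\<And>n. good n (p n) (p (Suc n))"
    using dependent_nat_choice[of "\<lambda>_. condition" good] by blast
  define L B u where "L n = fst (p n)" and "B n = fst (snd (p n))" and "u n = snd (snd (p n))" for n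
  have pn: "p n = (L n, B n, u n)" for n by (simp add: L_def B_def u_def)
  show thesis
  proof (rule that[of L B u])
    show "avoids (program c) (program d) s t (L (Suc n), B (Suc n), u (Suc n))"
      if "requirement n = (c, d)" "length s = Suc n" "length t = Suc n" "s \<noteq> t" for n s t c d
      using p(2)[of n] that unfolding good_def pn by force
  qed (use p(1) p(2)[unfolded good_def reindex_def pn] in \<open>simp_all add: pn\<close>)
qed

theorem theorem3:
  shows "\<exists>(X :: point set) (x :: (nat \<Rightarrow> bool) \<Rightarrow> point).
           minimal_subshift X \<and> (\<forall>z. x z \<in> X) \<and>
           (\<forall>z z'. z \<noteq> z' \<longrightarrow>
              \<not> point_turing_le (x z) (x z') \<and> \<not> point_turing_le (x z') (x z) \<and>
              \<not> (\<exists>y\<in>X. point_turing_le y (x z) \<and> point_turing_le y (x z')))"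
proof -
  obtain L B and u :: "nat \<Rightarrow> bool list \<Rightarrow> point" where B: "\<And>n. free_blocks (L n) (B n)" and u: "\<And>n i. u n i \<in> B n"
    and dec: "\<And>n. B (Suc n) \<subseteq> B n" and step: "\<And>n i. agree (L n) (u n (butlast i)) (u (Suc n) i)"
    and double: "\<And>n. 2 * L n \<le> L (Suc n)"
    and link: "\<And>n x y k. x \<in> B n \<Longrightarrow> y \<in> B (Suc n) \<Longrightarrow>
       \<exists>q. \<forall>j. 0 \<le> j \<and> j < 2 * L n \<longrightarrow> y (q + j) = x (k * L n + j)"
    and avoid: "\<And>n s t c d. requirement n = (c, d) \<Longrightarrow> length s = Suc n \<Longrightarrow> length t = Suc n \<Longrightarrow> s \<noteq> t \<Longrightarrow>
       avoids (program c) (program d) s t (L (Suc n), B (Suc n), u (Suc n))"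
  proof (rule ex_generic_sequence, goal_cases)
    case (1 L B u)
    show thesis by (rule that[of L B u]) (fact 1)+
  qed
  note Lpos = free_blocks_pos[OF B]
  \<comment> \<open>The windows exhaust the integers, so each branch determines a point.\<close>
  have Ln: "int n < L n" for n
  proof (induction n)
    case (Suc n)
    then show ?case using double[of n] by simp
  qed (use Lpos in simp)
  have Lmono: "L m \<le> L n" if "m \<le> n" for m n
    using lift_Suc_mono_le[of L, OF _ that] double Lpos by (smt (verit))
  have Bmono: "B n \<subseteq> B m" if "m \<le> n" for m n
    using lift_Suc_antimono_le[of B, OF dec that] .
  define X where "X = (\<Inter>n. translates (B n))"
  define v where "v z n = u n (map z [0..<n])" for z n
  have v_step: "agree (L n) (v z n) (v z (Suc n))" for z n
    using step[of n "map z [0..<Suc n]"] by (simp add: v_def)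
  have v_agree: "agree (L m) (v z m) (v z n)" if "m \<le> n" for z m n
    using that
  proof (induction n rule: dec_induct)
    case (step n)
    then show ?case using agree_trans agree_mono[OF v_step Lmono] by blast
  qed simp
  \<comment> \<open>Stage \<open>nat \<bar>m\<bar> + 1\<close> has a window that contains
    \<open>m\<close>; later stages do not change the value there.\<close>
  define x where "x z m = v z (nat \<bar>m\<bar> + 1) m" for z m
  have x_agree: "agree (L n) (v z n) (x z)" for z n
    unfolding agree_def
  proof (intro allI impI)
    fix m assume m: "- L n \<le> m \<and> m < L n"
    let ?n = "nat \<bar>m\<bar> + 1"
    have m': "- L ?n \<le> m \<and> m < L ?n" using Ln[of ?n] by simp linarith
    have "v z n m = v z ?n m"
    proof (cases "n \<le> ?n")
      case True
      then show ?thesis using v_agree[OF True] m by (simp add: agree_def)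
    next
      case False
      then have "?n \<le> n" by simp
      from v_agree[OF this] m' show ?thesis unfolding agree_def by metis
    qed
    then show "v z n m = x z m" by (simp add: x_def)
  qed
  have xB: "x z \<in> B n" for z n
  proof (rule free_blocks_closed[OF B])
    fix N
    let ?n = "max n (nat N)"
    have "v z ?n \<in> B n" using u Bmono[of n ?n] by (auto simp: v_def)
    moreover have "N \<le> L ?n" using Ln[of ?n] by linarith
    ultimately show "\<exists>y\<in>B n. agree N y (x z)" using agree_mono[OF x_agree] by blast
  qed
  then have xX: "x z \<in> X" for z using subset_translates by (auto simp: X_def)
  have "subshift X"
    unfolding subshift_def
  proof (intro conjI ballI)
    show "closedin cantor_top X"
      unfolding X_def by (intro closedin_Inter) (auto intro: closedin_translates[OF B])
    fix w assume "w \<in> X"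
    then show "shift w \<in> X" "shift_inv w \<in> X"
      using translates_shift[of w _ 1] translates_shift[of w _ "-1"]
      by (auto simp: X_def shift_def shift_inv_def)
  qed
  moreover have "\<exists>s. agree N (\<lambda>m. y (m + s)) w" if w: "w \<in> X" and y: "y \<in> X" for w y N
  proof -
    \<comment> \<open>At this stage the window of length \<open>2 * N\<close> is no longer than a
      block.\<close>
    define n where "n = nat (2 * N)"
    have N: "2 * N \<le> L n" using Ln[of n] unfolding n_def by linarith
    obtain p where p: "(\<lambda>m. w (m + p)) \<in> B n" using w by (auto simp: X_def translates_def)
    obtain p' where p': "(\<lambda>m. y (m + p')) \<in> B (Suc n)" using y by (force simp: X_def translates_def)
    \<comment> \<open>Block \<open>k\<close> of the aligned copy of \<open>w\<close> contains the
      left end \<open>-N\<close> of the window, so blocks \<open>k\<close> and \<open>k + 1\<close>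
      cover all of it.\<close>
    define k where "k = (- N - p) div L n"
    obtain q where q: "\<And>j. 0 \<le> j \<and> j < 2 * L n \<Longrightarrow> y (q + j + p') = w (k * L n + j + p)"
      using link[OF p p', of k] by blast
    have k: "k * L n \<le> - N - p" "- N - p < k * L n + L n"
    proof -
      have "k * L n + (- N - p) mod L n = - N - p" by (simp add: k_def)
      moreover have "0 \<le> (- N - p) mod L n" "(- N - p) mod L n < L n" using Lpos[of n] by simp_all
      ultimately show "k * L n \<le> - N - p" "- N - p < k * L n + L n" by linarith+
    qed
    have "y (m + (q + p' - k * L n - p)) = w m" if m: "- N \<le> m \<and> m < N" for m
    proof -
      have "0 \<le> m - p - k * L n \<and> m - p - k * L n < 2 * L n" using m k N by linarith
      from q[OF this] show ?thesis by (simp add: algebra_simps)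
    qed
    then show ?thesis unfolding agree_def by blast
  qed
  ultimately have "minimal_subshift X" using xX by (intro minimal_subshiftI) auto
  moreover have no_common: "\<not> (point_turing_le y (x z) \<and> point_turing_le y (x z'))"
    if "z \<noteq> z'" and y: "y \<in> X" for z z' y
  proof
    assume "point_turing_le y (x z) \<and> point_turing_le y (x z')"
    then obtain c d where cd: "maps_to (program c) (x z) y" "maps_to (program d) (x z') y"
      using point_turing_le_imp_program by blast
    obtain i where i: "z i \<noteq> z' i" using \<open>z \<noteq> z'\<close> by blast
    \<comment> \<open>Stage \<open>n\<close> treats words of length \<open>n + 1\<close>; by
      \<open>i \<le> n\<close> the two words include the index \<open>i\<close> and therefore
      differ.\<close>
    obtain n where n: "i \<le> n" "requirement n = (c, d)" using requirement_recurs by blast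
    have "map z [0..<Suc n] \<noteq> map z' [0..<Suc n]" using i n(1) by (auto simp del: upt_Suc)
    from avoid[OF n(2) _ _ this]
    have "avoids (program c) (program d) (map z [0..<Suc n]) (map z' [0..<Suc n])
        (L (Suc n), B (Suc n), u (Suc n))" by simp
    moreover have "y \<in> translates (B (Suc n))" using y by (simp add: X_def)
    ultimately show False
      using xB x_agree[of "Suc n"] cd unfolding avoids.simps v_def by blast
  qed
  ultimately show ?thesis
    using xX point_turing_le_refl by (intro exI[of _ X] exI[of _ x]) blast
qed

end
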